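(* For all $r\le\frac{1}{1+\sqrt2}$, the kernel $\ker i_{4,r}^*$ does not contain any class in $H^1(\mathrm{Conf}_4)$ for which the sum of coefficients of the generators is nonzero. If $r>\frac{1}{1+\sqrt2}$, then $\mathrm{Conf}_{4,r}$ is empty, so $\ker i_{4,r}^*$ contains all of $H^*(\mathrm{Conf}_4)$.
   Context: $D^2$ is the closed unit disk in $\mathbb{R}^2$. $\mathrm{Conf}_n$ is the space of ordered $n$-tuples $(x_1,\ldots,x_n)$ of distinct points of $D^2$. For $r>0$, $\mathrm{Conf}_{n,r}\subseteq\mathrm{Conf}_n$ is the subspace of those tuples for which the open disks of radius $r$ centered at $x_1,\ldots,x_n$ are pairwise disjoint and contained in $D^2$ (and $\mathrm{Conf}_{n,0}=\mathrm{Conf}_n$). $i_{n,r}:\mathrm{Conf}_{n,r}\to\mathrm{Conf}_n$ is the inclusion, and $i_{n,r}^*$ is the induced map on integral singular cohomology. The generators of $H^1(\mathrm{Conf}_4)$ are the six classes (one for each pair $1\le i<j\le 4$) obtained by pulling back the generator $d\theta$ of $H^1(S^1)$ along the map $\mathrm{Conf}_4\to S^1$, $\vec{x}\mapsto\frac{x_j-x_i}{|x_j-x_i|}$; by a theorem of Arnol'd they form a free basis of $H^1(\mathrm{Conf}_4)$. *)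

theory Defs
  imports "HOL-Homology.Homology"
begin

section \<open>Integral singular cohomology\<close>

text \<open>
  The cochain group is \<open>Hom(C\<^sub>p(X), \<int>)\<close>.  HOL functions are total, so a cochain is normalised to be
  \<open>undefined\<close> outside the singular chains; equality of cochains is then equality on chains.
\<close>

definition cochain_group :: "nat \<Rightarrow> 'a topology \<Rightarrow> ('a chain \<Rightarrow> int) monoid"
  where "cochain_group p X \<equiv>
    \<lparr>carrier = hom (chain_group p X) integer_group \<inter> extensional (singular_chain_set p X),
     monoid.mult = (\<lambda>\<phi> \<psi>. \<lambda>c\<in>singular_chain_set p X. \<phi> c + \<psi> c),
     one = (\<lambda>c\<in>singular_chain_set p X. 0)\<rparr>"

definition coboundary_map :: "nat \<Rightarrow> 'a topology \<Rightarrow> ('a chain \<Rightarrow> int) \<Rightarrow> 'a chain \<Rightarrow> int"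
  where "coboundary_map p X \<phi> \<equiv>
    \<lambda>c\<in>singular_chain_set (Suc p) X. \<phi> (chain_boundary (Suc p) c)"

definition cocycle_set :: "nat \<Rightarrow> 'a topology \<Rightarrow> ('a chain \<Rightarrow> int) set"
  where "cocycle_set p X \<equiv>
    kernel (cochain_group p X) (cochain_group (Suc p) X) (coboundary_map p X)"

definition coboundary_set :: "nat \<Rightarrow> 'a topology \<Rightarrow> ('a chain \<Rightarrow> int) set"
  where "coboundary_set p X \<equiv>
    (case p of 0 \<Rightarrow> {\<one>\<^bsub>cochain_group 0 X\<^esub>}
             | Suc q \<Rightarrow> coboundary_map q X ` carrier (cochain_group q X))"

definition cocycle_group :: "nat \<Rightarrow> 'a topology \<Rightarrow> ('a chain \<Rightarrow> int) monoid"
  where "cocycle_group p X \<equiv> subgroup_generated (cochain_group p X) (cocycle_set p X)"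

definition cohomology_group :: "nat \<Rightarrow> 'a topology \<Rightarrow> ('a chain \<Rightarrow> int) set monoid"
  where "cohomology_group p X \<equiv> cocycle_group p X Mod coboundary_set p X"

definition cochain_pullback ::
    "nat \<Rightarrow> 'a topology \<Rightarrow> ('a \<Rightarrow> 'b) \<Rightarrow> ('b chain \<Rightarrow> int) \<Rightarrow> 'a chain \<Rightarrow> int"
  where "cochain_pullback p X f \<phi> \<equiv> \<lambda>c\<in>singular_chain_set p X. \<phi> (chain_map p f c)"

text \<open>
  For \<open>f\<close> continuous from \<open>X\<close> to \<open>Y\<close>, the map \<open>f\<^sup>*\<close> from the cohomology of \<open>Y\<close> to that of \<open>X\<close>:
  all representatives of a class have cohomologous pullbacks, so that \<open>the_elem\<close> is
  applied to a singleton (see \<open>cohom_induced_coset\<close> below).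
\<close>

definition cohom_induced ::
    "nat \<Rightarrow> 'a topology \<Rightarrow> ('a \<Rightarrow> 'b) \<Rightarrow> ('b chain \<Rightarrow> int) set \<Rightarrow> ('a chain \<Rightarrow> int) set"
  where "cohom_induced p X f z \<equiv>
    the_elem ((\<lambda>\<phi>. coboundary_set p X #>\<^bsub>cocycle_group p X\<^esub> cochain_pullback p X f \<phi>) ` z)"


subsection \<open>Well-definedness\<close>

lemma carrier_cochain_group:
  "\<phi> \<in> carrier (cochain_group p X) \<longleftrightarrow>
     \<phi> \<in> extensional (singular_chain_set p X) \<and>
     (\<forall>a b. singular_chain p X a \<longrightarrow> singular_chain p X b \<longrightarrow> \<phi> (a + b) = \<phi> a + \<phi> b)"
  by (auto simp: cochain_group_def hom_def)

lemma mult_cochain_group: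
  "\<phi> \<otimes>\<^bsub>cochain_group p X\<^esub> \<psi> = (\<lambda>c\<in>singular_chain_set p X. \<phi> c + \<psi> c)"
  by (simp add: cochain_group_def)

lemma one_cochain_group: "\<one>\<^bsub>cochain_group p X\<^esub> = (\<lambda>c\<in>singular_chain_set p X. 0)"
  by (simp add: cochain_group_def)

lemma comm_group_cochain_group: "comm_group (cochain_group p X)"
proof (rule comm_groupI)
  fix \<phi> assume \<phi>: "\<phi> \<in> carrier (cochain_group p X)"
  show "\<exists>\<psi>\<in>carrier (cochain_group p X). \<psi> \<otimes>\<^bsub>cochain_group p X\<^esub> \<phi> = \<one>\<^bsub>cochain_group p X\<^esub>"
  proof
    show "(\<lambda>c\<in>singular_chain_set p X. - \<phi> c) \<in> carrier (cochain_group p X)"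
      using \<phi> by (auto simp: carrier_cochain_group singular_chain_add)
  qed (auto simp: mult_cochain_group one_cochain_group)
next
  fix \<phi> assume "\<phi> \<in> carrier (cochain_group p X)"
  then show "\<one>\<^bsub>cochain_group p X\<^esub> \<otimes>\<^bsub>cochain_group p X\<^esub> \<phi> = \<phi>"
    by (auto simp: mult_cochain_group one_cochain_group carrier_cochain_group extensional_def)
qed (auto simp: carrier_cochain_group mult_cochain_group one_cochain_group singular_chain_add)

lemma group_cochain_group [simp]: "group (cochain_group p X)"
  using comm_group_cochain_group comm_group_def by blast

lemma coboundary_map_hom:
  "coboundary_map p X \<in> hom (cochain_group p X) (cochain_group (Suc p) X)"
proof (rule homI)
  fix \<phi> \<psi> assume "\<phi> \<in> carrier (cochain_group p X)" "\<psi> \<in> carrier (cochain_group p X)"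
  show "coboundary_map p X (\<phi> \<otimes>\<^bsub>cochain_group p X\<^esub> \<psi>)
      = coboundary_map p X \<phi> \<otimes>\<^bsub>cochain_group (Suc p) X\<^esub> coboundary_map p X \<psi>"
    by (auto simp: coboundary_map_def mult_cochain_group singular_chain_boundary_alt)
qed (auto simp: carrier_cochain_group coboundary_map_def chain_boundary_add
        singular_chain_boundary_alt singular_chain_add)

lemma cochain_pullback_hom:
  assumes "continuous_map X Y f"
  shows "cochain_pullback p X f \<in> hom (cochain_group p Y) (cochain_group p X)"
proof (rule homI)
  fix \<phi> \<psi> assume "\<phi> \<in> carrier (cochain_group p Y)" "\<psi> \<in> carrier (cochain_group p Y)"
  show "cochain_pullback p X f (\<phi> \<otimes>\<^bsub>cochain_group p Y\<^esub> \<psi>)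
      = cochain_pullback p X f \<phi> \<otimes>\<^bsub>cochain_group p X\<^esub> cochain_pullback p X f \<psi>"
    using assms
    by (auto simp: cochain_pullback_def mult_cochain_group singular_chain_chain_map)
next
  fix \<phi> assume "\<phi> \<in> carrier (cochain_group p Y)"
  then show "cochain_pullback p X f \<phi> \<in> carrier (cochain_group p X)"
    using assms by (auto simp: carrier_cochain_group cochain_pullback_def chain_map_add
        singular_chain_chain_map singular_chain_add)
qed

lemma coboundary_map_pullback:
  assumes "continuous_map X Y f"
  shows "coboundary_map p X (cochain_pullback p X f \<phi>)
       = cochain_pullback (Suc p) X f (coboundary_map p Y \<phi>)"
  using assms
  by (auto simp: coboundary_map_def cochain_pullback_def fun_eq_iff restrict_def
      singular_chain_boundary_alt singular_chain_chain_map chain_boundary_chain_map)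

lemma group_hom_coboundary_map:
  "group_hom (cochain_group p X) (cochain_group (Suc p) X) (coboundary_map p X)"
  by (simp add: group_hom_def group_hom_axioms_def coboundary_map_hom)

lemma group_hom_cochain_pullback:
  assumes "continuous_map X Y f"
  shows "group_hom (cochain_group p Y) (cochain_group p X) (cochain_pullback p X f)"
  by (simp add: group_hom_def group_hom_axioms_def cochain_pullback_hom assms)

lemma subgroup_cocycle_set: "subgroup (cocycle_set p X) (cochain_group p X)"
  unfolding cocycle_set_def by (rule group_hom.subgroup_kernel [OF group_hom_coboundary_map])

lemma carrier_cocycle_group [simp]: "carrier (cocycle_group p X) = cocycle_set p X"
  unfolding cocycle_group_def
  by (rule subgroup.carrier_subgroup_generated_subgroup [OF subgroup_cocycle_set])

lemma mult_cocycle_group [simp]: "(\<otimes>\<^bsub>cocycle_group p X\<^esub>) = (\<otimes>\<^bsub>cochain_group p X\<^esub>)"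
  by (simp add: cocycle_group_def)

lemma comm_group_cocycle_group: "comm_group (cocycle_group p X)"
  unfolding cocycle_group_def
  by (rule group.abelian_subgroup_generated) (simp_all add: comm_group_cochain_group)

lemma subgroup_coboundary_set: "subgroup (coboundary_set p X) (cochain_group p X)"
proof (cases p)
  case 0
  then show ?thesis by (simp add: coboundary_set_def group.triv_subgroup)
next
  case (Suc q)
  then show ?thesis
    using group_hom.img_is_subgroup [OF group_hom_coboundary_map] by (simp add: coboundary_set_def)
qed

lemma coboundary_set_subset: "coboundary_set p X \<subseteq> cocycle_set p X"
proof (cases p)
  case 0
  then show ?thesis
    using subgroup.one_closed [OF subgroup_cocycle_set] by (auto simp: coboundary_set_def)
next
  case (Suc q)
  have "coboundary_map (Suc q) X (coboundary_map q X \<phi>) = \<one>\<^bsub>cochain_group (Suc (Suc q)) X\<^esub>"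
    if \<phi>: "\<phi> \<in> carrier (cochain_group q X)" for \<phi>
  proof -
    have "\<phi> (0 + 0) = \<phi> 0 + \<phi> 0"
      using \<phi> by (simp only: carrier_cochain_group singular_chain_0)
    then have "\<phi> 0 = 0" by simp
    then show ?thesis
      using chain_boundary_boundary_alt [of "Suc q" X]
      by (auto simp: coboundary_map_def one_cochain_group fun_eq_iff restrict_def
          singular_chain_boundary_alt)
  qed
  then show ?thesis
    using Suc hom_in_carrier [OF coboundary_map_hom]
    by (auto simp: coboundary_set_def cocycle_set_def kernel_def)
qed

lemma subgroup_coboundary_cocycle: "subgroup (coboundary_set p X) (cocycle_group p X)"
  unfolding cocycle_group_def
  by (simp add: group.subgroup_of_subgroup_generated coboundary_set_subset subgroup_coboundary_set)

lemma comm_group_cohomology_group: "comm_group (cohomology_group p X)"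
  unfolding cohomology_group_def
  by (rule comm_group.abelian_FactGroup [OF comm_group_cocycle_group subgroup_coboundary_cocycle])

lemma cochain_pullback_cocycle:
  assumes "continuous_map X Y f" "\<phi> \<in> cocycle_set p Y"
  shows "cochain_pullback p X f \<phi> \<in> cocycle_set p X"
  using assms hom_in_carrier [OF cochain_pullback_hom [OF assms(1)]]
    group_hom.hom_one [OF group_hom_cochain_pullback [OF assms(1)]]
  by (auto simp: cocycle_set_def kernel_def coboundary_map_pullback)

lemma cochain_pullback_coboundary:
  assumes "continuous_map X Y f" "\<phi> \<in> coboundary_set p Y"
  shows "cochain_pullback p X f \<phi> \<in> coboundary_set p X"
proof (cases p)
  case 0
  then show ?thesis
    using assms group_hom.hom_one [OF group_hom_cochain_pullback [OF assms(1)]]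
    by (simp add: coboundary_set_def)
next
  case (Suc q)
  then obtain \<psi> where "\<psi> \<in> carrier (cochain_group q Y)" "\<phi> = coboundary_map q Y \<psi>"
    using assms by (auto simp: coboundary_set_def)
  then show ?thesis
    using Suc assms hom_in_carrier [OF cochain_pullback_hom [OF assms(1)]]
    by (auto simp: coboundary_set_def simp flip: coboundary_map_pullback)
qed

lemma cohom_induced_coset:
  assumes f: "continuous_map X Y f" and \<phi>: "\<phi> \<in> cocycle_set p Y"
  shows "cohom_induced p X f (coboundary_set p Y #>\<^bsub>cocycle_group p Y\<^esub> \<phi>)
       = coboundary_set p X #>\<^bsub>cocycle_group p X\<^esub> cochain_pullback p X f \<phi>"
proof -
  interpret G: comm_group "cocycle_group p X" by (rule comm_group_cocycle_group)
  interpret H: comm_group "cocycle_group p Y" by (rule comm_group_cocycle_group)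
  let ?F = "\<lambda>\<phi>. coboundary_set p X #>\<^bsub>cocycle_group p X\<^esub> cochain_pullback p X f \<phi>"
  have "?F \<psi> = ?F \<phi>" if \<psi>: "\<psi> \<in> coboundary_set p Y #>\<^bsub>cocycle_group p Y\<^esub> \<phi>" for \<psi>
  proof -
    obtain b where b: "b \<in> coboundary_set p Y" and eq: "\<psi> = b \<otimes>\<^bsub>cochain_group p Y\<^esub> \<phi>"
      using \<psi> by (auto simp: r_coset_def)
    have car: "b \<in> carrier (cochain_group p Y)" "\<phi> \<in> carrier (cochain_group p Y)"
      using b \<phi> subgroup.subset [OF subgroup_coboundary_set] by (auto simp: cocycle_set_def kernel_def)
    have "cochain_pullback p X f \<psi>
        = cochain_pullback p X f b \<otimes>\<^bsub>cocycle_group p X\<^esub> cochain_pullback p X f \<phi>"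
      using hom_mult [OF cochain_pullback_hom [OF f] car] by (simp add: eq)
    then have "cochain_pullback p X f \<psi> \<in> ?F \<phi>"
      using cochain_pullback_coboundary [OF f b] by (auto simp: r_coset_def)
    then show ?thesis
      using G.repr_independence [OF _ _ subgroup_coboundary_cocycle]
        cochain_pullback_cocycle [OF f \<phi>] by simp
  qed
  moreover have "\<phi> \<in> coboundary_set p Y #>\<^bsub>cocycle_group p Y\<^esub> \<phi>"
    using H.rcos_self [OF _ subgroup_coboundary_cocycle] \<phi> by simp
  ultimately have "?F ` (coboundary_set p Y #>\<^bsub>cocycle_group p Y\<^esub> \<phi>) = {?F \<phi>}"
    by blast
  then show ?thesis
    by (simp add: cohom_induced_def)
qed


section \<open>Configuration spaces of the disk\<close>

text \<open>Points of the plane are labelled by \<open>1, \<dots>, n\<close>; tuples are \<open>undefined\<close> off \<open>{1..n}\<close>.\<close>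

definition conf_set :: "nat \<Rightarrow> (nat \<Rightarrow> real ^ 2) set"
  where "conf_set n \<equiv> {x \<in> {1..n} \<rightarrow>\<^sub>E cball 0 1. inj_on x {1..n}}"

text \<open>For \<open>r = 0\<close> the open disks are empty, so that this is \<open>conf_set n\<close>.\<close>

definition disk_conf_set :: "nat \<Rightarrow> real \<Rightarrow> (nat \<Rightarrow> real ^ 2) set"
  where "disk_conf_set n r \<equiv>
    {x \<in> conf_set n. disjoint_family_on (\<lambda>i. ball (x i) r) {1..n} \<and>
                     (\<forall>i\<in>{1..n}. ball (x i) r \<subseteq> cball 0 1)}"

definition Conf :: "nat \<Rightarrow> (nat \<Rightarrow> real ^ 2) topology"
  where "Conf n \<equiv> subtopology (product_topology (\<lambda>_. euclidean) {1..n}) (conf_set n)"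

definition disk_Conf :: "nat \<Rightarrow> real \<Rightarrow> (nat \<Rightarrow> real ^ 2) topology"
  where "disk_Conf n r \<equiv> subtopology (Conf n) (disk_conf_set n r)"

lemma topspace_Conf: "topspace (Conf n) = conf_set n"
  by (auto simp: Conf_def conf_set_def)

lemma topspace_disk_Conf: "topspace (disk_Conf n r) = disk_conf_set n r"
  by (auto simp: disk_Conf_def topspace_Conf disk_conf_set_def)

lemma disk_Conf_0: "disk_Conf n 0 = Conf n"
proof -
  have "disk_conf_set n 0 = topspace (Conf n)"
    by (auto simp: topspace_Conf disk_conf_set_def disjoint_family_on_def)
  then show ?thesis
    by (simp add: disk_Conf_def)
qed

definition incl_pullback ::
    "nat \<Rightarrow> nat \<Rightarrow> real \<Rightarrow> ((nat \<Rightarrow> real ^ 2) chain \<Rightarrow> int) set \<Rightarrow> ((nat \<Rightarrow> real ^ 2) chain \<Rightarrow> int) set"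
  where "incl_pullback p n r \<equiv> cohom_induced p (disk_Conf n r) id"

lemma continuous_map_inclusion: "continuous_map (disk_Conf n r) (Conf n) id"
  by (simp add: disk_Conf_def continuous_map_from_subtopology)


section \<open>The generators in degree one\<close>

abbreviation circle :: "(real ^ 2) topology"
  where "circle \<equiv> top_of_set (sphere 0 1)"

definition direction :: "nat \<Rightarrow> nat \<Rightarrow> (nat \<Rightarrow> real ^ 2) \<Rightarrow> real ^ 2"
  where "direction i j x \<equiv> (x j - x i) /\<^sub>R norm (x j - x i)"

lemma continuous_map_direction:
  assumes "i \<in> {1..n}" "j \<in> {1..n}" "i \<noteq> j"
  shows "continuous_map (Conf n) circle (direction i j)"
proof -
  have ne: "x j - x i \<noteq> 0" if "x \<in> topspace (Conf n)" for x
  proof -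
    have "inj_on x {1..n}"
      using that by (simp add: topspace_Conf conf_set_def)
    then have "x i \<noteq> x j"
      using assms by (simp add: inj_on_eq_iff)
    then show ?thesis by simp
  qed
  have *: "continuous_map (Conf n) euclidean (\<lambda>x. x k)" if "k \<in> {1..n}" for k
    using that unfolding Conf_def
    by (intro continuous_map_from_subtopology continuous_map_product_projection)
  have diff: "continuous_map (Conf n) euclidean (\<lambda>x. x j - x i)"
    using assms by (intro continuous_map_diff *)
  have "limitin euclidean (direction i j) (direction i j x) (atin (Conf n) x)"
    if x: "x \<in> topspace (Conf n)" for x
  proof -
    have "((\<lambda>x. x j - x i) \<longlongrightarrow> x j - x i) (atin (Conf n) x)"
      using diff x by (simp add: continuous_map_atin)
    then have "((\<lambda>x. (x j - x i) /\<^sub>R norm (x j - x i)) \<longlongrightarrow> (x j - x i) /\<^sub>R norm (x j - x i))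
                 (atin (Conf n) x)"
      using ne [OF x] by (intro tendsto_scaleR tendsto_inverse tendsto_norm) simp_all
    then show ?thesis
      by (simp add: direction_def [abs_def])
  qed
  then have "continuous_map (Conf n) euclidean (direction i j)"
    by (simp add: continuous_map_atin)
  moreover have "direction i j x \<in> sphere 0 1" if "x \<in> topspace (Conf n)" for x
    using ne [OF that] by (simp add: direction_def)
  ultimately show ?thesis
    by (simp add: continuous_map_in_subtopology image_subset_iff Pi_iff)
qed

definition is_generator :: "('a, 'b) monoid_scheme \<Rightarrow> 'a \<Rightarrow> bool"
  where "is_generator G a \<equiv> a \<in> carrier G \<and> generate G {a} = carrier G"

definition index_pairs :: "nat \<Rightarrow> (nat \<times> nat) set"
  where "index_pairs n \<equiv> {(i, j). 1 \<le> i \<and> i < j \<and> j \<le> n}"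

text \<open>
  \<open>d\<theta>\<close> stands for a generator of the first cohomology of the circle.  There are two, differing by
  sign; it is left as a parameter, so that nothing depends on the orientation.
\<close>

definition conf_generator ::
    "nat \<Rightarrow> ((real ^ 2) chain \<Rightarrow> int) set \<Rightarrow> nat \<times> nat \<Rightarrow> ((nat \<Rightarrow> real ^ 2) chain \<Rightarrow> int) set"
  where "conf_generator n d\<theta> \<equiv> \<lambda>(i, j). cohom_induced 1 (Conf n) (direction i j) d\<theta>"

end

theory Submission
  imports Defs
begin

text \<open>
  The idea for small \<open>r\<close>: four disks of radius \<open>r \<le> 1 / (1 + \<surd>2)\<close> fit into the unit disk with their
  centres at the vertices of a square, and this square can be turned rigidly about the origin.  That
  is a loop in the configuration space of disks along which every direction vector from one point to
  another makes exactly one positive turn.  Restricting to this loop therefore sends all six generators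
  to the same class \<open>d\<theta>\<close> of the circle, hence sends a class with coefficients \<open>c\<close> to \<open>(\<Sum>c) d\<theta>\<close>, and
  \<open>d\<theta>\<close> has infinite order.  A class that vanishes on the disk configurations thus has \<open>\<Sum>c = 0\<close>.

  This is carried out with the Kronecker pairing, which evaluates a cohomology class on a cycle
  (\<open>kronecker\<close>).  For a fixed cycle it is a homomorphism to \<open>\<int>\<close> (\<open>kronecker_hom\<close>), it is natural
  (\<open>kronecker_cohom_induced\<close>), and it does not distinguish homotopic maps (\<open>kronecker_homotopic\<close>).
  This last property is where the homotopy invariance of singular homology enters.  The class \<open>d\<theta>\<close> has
  infinite order because it pairs nontrivially with some cycle (\<open>generator_detected_by_cycle\<close>): the
  isomorphism from the first homology of the circle to \<open>\<int>\<close> is the evaluation of some cocycle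
  (\<open>cocycle_extending_homology_hom\<close>), and the
  class of this cocycle is a multiple of \<open>d\<theta>\<close>.

  For large \<open>r\<close>, the centres lie within \<open>1 - r\<close> of the origin and at distance at least
  \<open>2 r > \<surd>2 (1 - r)\<close> from each other, so that any two of the four position vectors form an obtuse angle.
  The plane has room for only three such vectors (\<open>no_four_obtuse_vectors\<close>).  Hence there are no disk
  configurations, and the cohomology of the empty space vanishes.
\<close>

section \<open>The Kronecker pairing\<close>

lemma cochain_zero:
  assumes "\<phi> \<in> carrier (cochain_group p X)" shows "\<phi> 0 = 0"
proof -
  have "\<phi> (0 + 0) = \<phi> 0 + \<phi> 0"
    using assms unfolding carrier_cochain_group by (metis singular_chain_0)
  then show ?thesis by simp
qed

lemma cochain_diff:
  assumes "\<phi> \<in> carrier (cochain_group p X)" "singular_chain p X a" "singular_chain p X b"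
  shows "\<phi> (a - b) = \<phi> a - \<phi> b"
proof -
  have "\<phi> ((a - b) + b) = \<phi> (a - b) + \<phi> b"
    using assms unfolding carrier_cochain_group by (metis singular_chain_diff)
  then show ?thesis by simp
qed

lemma cocycle_carrier: "\<phi> \<in> cocycle_set p X \<Longrightarrow> \<phi> \<in> carrier (cochain_group p X)"
  by (simp add: cocycle_set_def kernel_def)

lemma cocycle_boundary:
  assumes "\<phi> \<in> cocycle_set p X" "singular_chain (Suc p) X d"
  shows "\<phi> (chain_boundary (Suc p) d) = 0"
proof -
  have "coboundary_map p X \<phi> d = \<one>\<^bsub>cochain_group (Suc p) X\<^esub> d"
    using assms by (simp add: cocycle_set_def kernel_def)
  then show ?thesis
    using assms by (simp add: coboundary_map_def one_cochain_group)
qed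

lemma cocycle_homologous:
  assumes \<phi>: "\<phi> \<in> cocycle_set p X" and hom: "homologous_rel p X {} a b"
    and a: "singular_chain p X a"
  shows "\<phi> a = \<phi> b"
proof -
  have b: "singular_chain p X b"
    using a homologous_rel_singular_chain [OF hom] by simp
  obtain d where d: "singular_chain (Suc p) X d" "chain_boundary (Suc p) d = a - b"
    using hom by (auto simp: homologous_rel_def singular_boundary)
  then have "\<phi> (a - b) = 0"
    using cocycle_boundary [OF \<phi> d(1)] by simp
  then show ?thesis
    using cochain_diff [OF cocycle_carrier [OF \<phi>] a b] by simp
qed

text \<open>
  A coboundary takes its value at \<open>c\<close> from the boundary of \<open>c\<close>.  In degree \<open>0\<close> only the zero cochain
  counts as a coboundary.
\<close>
lemma coboundary_cycle:
  assumes b: "b \<in> coboundary_set p X" and c: "singular_relcycle p X {} c"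
  shows "b c = 0"
proof (cases p)
  case 0
  then show ?thesis
    using b c by (simp add: coboundary_set_def one_cochain_group singular_cycle)
next
  case (Suc q)
  then obtain \<psi> where "\<psi> \<in> carrier (cochain_group q X)" "b = coboundary_map q X \<psi>"
    using b by (auto simp: coboundary_set_def)
  then show ?thesis
    using Suc c cochain_zero by (auto simp: coboundary_map_def singular_cycle)
qed

text \<open>
  The pairing of a class with a cycle.  A class is a coset of cocycles, which all take the same value
  on a given cycle (see \<open>kronecker_coset\<close> below).
\<close>
definition kronecker :: "'a chain \<Rightarrow> ('a chain \<Rightarrow> int) set \<Rightarrow> int"
  where "kronecker c A \<equiv> the_elem ((\<lambda>\<phi>. \<phi> c) ` A)"

lemma kronecker_coset:
  assumes \<phi>: "\<phi> \<in> cocycle_set p X" and c: "singular_relcycle p X {} c"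
  shows "kronecker c (coboundary_set p X #>\<^bsub>cocycle_group p X\<^esub> \<phi>) = \<phi> c"
proof -
  let ?A = "coboundary_set p X #>\<^bsub>cocycle_group p X\<^esub> \<phi>"
  interpret G: comm_group "cocycle_group p X" by (rule comm_group_cocycle_group)
  have "\<psi> c = \<phi> c" if "\<psi> \<in> ?A" for \<psi>
    using that c coboundary_cycle [OF _ c]
    by (auto simp: r_coset_def mult_cochain_group singular_cycle)
  moreover have "\<phi> \<in> ?A"
    using G.rcos_self [OF _ subgroup_coboundary_cocycle] \<phi> by simp
  ultimately have "(\<lambda>\<psi>. \<psi> c) ` ?A = {\<phi> c}"
    by blast
  then show ?thesis
    by (simp add: kronecker_def)
qed

lemma cohomology_class_cases:
  assumes "A \<in> carrier (cohomology_group p X)"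
  obtains \<phi> where "\<phi> \<in> cocycle_set p X" "A = coboundary_set p X #>\<^bsub>cocycle_group p X\<^esub> \<phi>"
  using assms by (auto simp: cohomology_group_def FactGroup_def RCOSETS_def)

lemma coset_in_cohomology:
  assumes "\<phi> \<in> cocycle_set p X"
  shows "coboundary_set p X #>\<^bsub>cocycle_group p X\<^esub> \<phi> \<in> carrier (cohomology_group p X)"
  using assms by (auto simp: cohomology_group_def FactGroup_def RCOSETS_def)

lemma kronecker_hom:
  assumes c: "singular_relcycle p X {} c"
  shows "kronecker c \<in> hom (cohomology_group p X) integer_group"
proof (rule homI)
  fix A B assume A: "A \<in> carrier (cohomology_group p X)" and B: "B \<in> carrier (cohomology_group p X)"
  interpret G: comm_group "cocycle_group p X" by (rule comm_group_cocycle_group)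
  have normal: "coboundary_set p X \<lhd> cocycle_group p X"
    by (simp add: G.normal_iff_subgroup subgroup_coboundary_cocycle)
  obtain \<phi> \<psi> where \<phi>: "\<phi> \<in> cocycle_set p X" "A = coboundary_set p X #>\<^bsub>cocycle_group p X\<^esub> \<phi>"
    and \<psi>: "\<psi> \<in> cocycle_set p X" "B = coboundary_set p X #>\<^bsub>cocycle_group p X\<^esub> \<psi>"
    using A B cohomology_class_cases by metis
  have mult: "A \<otimes>\<^bsub>cohomology_group p X\<^esub> B
      = coboundary_set p X #>\<^bsub>cocycle_group p X\<^esub> (\<phi> \<otimes>\<^bsub>cocycle_group p X\<^esub> \<psi>)"
    using normal.rcos_sum [OF normal, of \<phi> \<psi>] \<phi> \<psi> by (simp add: cohomology_group_def FactGroup_def)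
  have closed: "\<phi> \<otimes>\<^bsub>cocycle_group p X\<^esub> \<psi> \<in> cocycle_set p X"
    using G.m_closed [of \<phi> \<psi>] \<phi> \<psi> by simp
  have "(\<phi> \<otimes>\<^bsub>cocycle_group p X\<^esub> \<psi>) c = \<phi> c + \<psi> c"
    using c by (simp add: mult_cochain_group singular_cycle)
  then show "kronecker c (A \<otimes>\<^bsub>cohomology_group p X\<^esub> B)
      = kronecker c A \<otimes>\<^bsub>integer_group\<^esub> kronecker c B"
    using kronecker_coset [OF closed c] kronecker_coset [OF \<phi>(1) c] kronecker_coset [OF \<psi>(1) c]
    unfolding mult by (simp only: \<phi>(2) \<psi>(2) mult_integer_group)
qed simp

lemma cohom_induced_closed:
  assumes "continuous_map X Y f" "A \<in> carrier (cohomology_group p Y)"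
  shows "cohom_induced p X f A \<in> carrier (cohomology_group p X)"
  using assms by (metis cohom_induced_coset coset_in_cohomology cochain_pullback_cocycle cohomology_class_cases)

lemma cycle_chain_map:
  assumes "continuous_map X Y f" "singular_relcycle p X {} c"
  shows "singular_relcycle p Y {} (chain_map p f c)"
  using assms by (auto intro: singular_relcycle_chain_map)

lemma kronecker_cohom_induced:
  assumes f: "continuous_map X Y f" and A: "A \<in> carrier (cohomology_group p Y)"
    and c: "singular_relcycle p X {} c"
  shows "kronecker c (cohom_induced p X f A) = kronecker (chain_map p f c) A"
proof -
  obtain \<phi> where \<phi>: "\<phi> \<in> cocycle_set p Y" "A = coboundary_set p Y #>\<^bsub>cocycle_group p Y\<^esub> \<phi>"
    using A by (rule cohomology_class_cases)
  have "kronecker c (cohom_induced p X f A) = cochain_pullback p X f \<phi> c"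
    by (simp add: \<phi> cohom_induced_coset [OF f] kronecker_coset [OF cochain_pullback_cocycle [OF f] c])
  also have "\<dots> = \<phi> (chain_map p f c)"
    using c by (simp add: cochain_pullback_def singular_cycle)
  also have "\<dots> = kronecker (chain_map p f c) A"
    by (simp add: \<phi> kronecker_coset [OF \<phi>(1) cycle_chain_map [OF f c]])
  finally show ?thesis .
qed

lemma kronecker_homologous:
  assumes A: "A \<in> carrier (cohomology_group p X)"
    and c: "singular_relcycle p X {} c" and hom: "homologous_rel p X {} c c'"
  shows "kronecker c A = kronecker c' A"
proof -
  obtain \<phi> where \<phi>: "\<phi> \<in> cocycle_set p X" "A = coboundary_set p X #>\<^bsub>cocycle_group p X\<^esub> \<phi>"
    using A by (rule cohomology_class_cases)
  have c': "singular_relcycle p X {} c'"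
    using c hom homologous_rel_singular_relcycle by blast
  show ?thesis
    using cocycle_homologous [OF \<phi>(1) hom] c
    unfolding \<phi>(2) kronecker_coset [OF \<phi>(1) c] kronecker_coset [OF \<phi>(1) c'] by (simp add: singular_cycle)
qed

text \<open>
  Homotopic maps send a cycle to homologous cycles, and a cocycle cannot tell these apart.
\<close>
lemma kronecker_homotopic:
  assumes fg: "homotopic_with (\<lambda>_. True) X Y f g" and A: "A \<in> carrier (cohomology_group p Y)"
    and c: "singular_relcycle p X {} c"
  shows "kronecker (chain_map p f c) A = kronecker (chain_map p g c) A"
proof (rule kronecker_homologous [OF A])
  show "singular_relcycle p Y {} (chain_map p f c)"
    using cycle_chain_map homotopic_with_imp_continuous_maps [OF fg] c by blast
  show "homologous_rel p Y {} (chain_map p f c) (chain_map p g c)"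
    by (rule homotopic_imp_homologous_rel_chain_maps [OF _ c]) (simp add: fg)
qed

section \<open>The first cohomology of the circle\<close>

text \<open>
  The surjectivity of the Kronecker map \<open>H\<^sup>1(X) \<rightarrow> Hom(H\<^sub>1(X), \<int>)\<close>, the part of the universal coefficient
  theorem that is needed here.  A homomorphism on \<open>H\<^sub>1\<close> gives one on cycles, which has to be extended to
  all chains; for this it suffices to retract \<open>C\<^sub>1\<close> onto the cycles.  When \<open>X\<close> is path connected, such a
  retraction turns every singular path into a loop by joining its ends to a fixed base point.
\<close>
lemma cocycle_extending_homology_hom:
  assumes X: "path_connected_space X" and h: "h \<in> hom (homology_group 1 X) integer_group"
  obtains \<phi> where "\<phi> \<in> cocycle_set 1 X"
    "\<And>c. singular_relcycle 1 X {} c \<Longrightarrow> \<phi> c = h (homologous_rel_set 1 X {} c)"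
proof -
  define f0 where "f0 = (SOME f. singular_simplex 0 X f)"
  \<comment> \<open>\<open>P f\<close> is a chain joining \<open>f\<close> to the base point \<open>f0\<close>; \<open>Q\<close> is the retraction onto the cycles.\<close>
  define P where "P f = (SOME d. singular_chain (Suc 0) X d \<and>
                            chain_boundary (Suc 0) d = frag_of f - frag_of f0)" for f
  define Q where "Q c = c - frag_extend P (chain_boundary 1 c)" for c
  have P: "singular_chain 1 X (P f) \<and> chain_boundary 1 (P f) = frag_of f - frag_of f0"
    if f: "singular_simplex 0 X f" for f
  proof -
    have "singular_simplex 0 X f0"
      unfolding f0_def by (rule someI [of "singular_simplex 0 X", OF f])
    then have "\<exists>d. singular_chain (Suc 0) X d \<and> chain_boundary (Suc 0) d = frag_of f - frag_of f0"
      using iso_integer_zeroth_homology_group_aux [OF X f] by (simp add: homologous_rel_def singular_boundary)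
    then have "singular_chain (Suc 0) X (P f) \<and> chain_boundary (Suc 0) (P f) = frag_of f - frag_of f0"
      unfolding P_def by (rule someI_ex)
    then show ?thesis by simp
  qed
  have chainP: "singular_chain 1 X (frag_extend P a)" if "singular_chain 0 X a" for a
    using that P by (auto simp: singular_chain_def [of 0] intro!: singular_chain_extend)
  \<comment> \<open>The base point drops out, since the two ends of a path enter its boundary with opposite signs.\<close>
  have bdP: "chain_boundary 1 (frag_extend P (chain_boundary 1 c)) = chain_boundary 1 c"
    if "singular_chain 1 X c" for c
    using that unfolding singular_chain_def
  proof (induction c rule: frag_induction)
    case (one g)
    have "singular_simplex 0 X (singular_face 1 0 g)" "singular_simplex 0 X (singular_face 1 1 g)"
      using one singular_simplex_singular_face [of 1 X g] by auto
    then show ?case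
      using P by (simp add: chain_boundary_of chain_boundary_diff frag_extend_diff)
  next
    case (diff a b)
    then show ?case
      by (simp add: chain_boundary_diff frag_extend_diff)
  qed simp
  have Q_cycle: "singular_relcycle 1 X {} (Q c)" if "singular_chain 1 X c" for c
    using that bdP [OF that] chainP singular_chain_boundary [OF that]
    by (simp add: singular_cycle Q_def chain_boundary_diff singular_chain_diff)
  have Q_add: "Q (a + b) = Q a + Q b" for a b
    by (simp add: Q_def chain_boundary_add frag_extend_add)
  define k where "k c = h (homologous_rel_set 1 X {} c)" for c
  have k_add: "k (a + b) = k a + k b" if "singular_relcycle 1 X {} a" "singular_relcycle 1 X {} b" for a b
  proof -
    have grp: "homology_group 1 X = relcycle_group 1 X {} Mod singular_relboundary_set 1 X {}"
      using nontrivial_relative_homology_group [of 1 X "{}"] by simp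
    have eq: "homologous_rel_set 1 X {} (a + b)
        = homologous_rel_set 1 X {} a \<otimes>\<^bsub>homology_group 1 X\<^esub> homologous_rel_set 1 X {} b"
      using normal.rcos_sum [OF normal_subgroup_singular_relboundary_relcycle [of 1 X "{}"], of a b] that
      by (simp add: grp FactGroup_def right_coset_singular_relboundary)
    have "homologous_rel_set 1 X {} a \<in> carrier (homology_group 1 X)"
         "homologous_rel_set 1 X {} b \<in> carrier (homology_group 1 X)"
      using that carrier_relative_homology_group [of 1 X "{}"] by auto
    then show ?thesis
      unfolding k_def eq by (simp only: hom_mult [OF h] mult_integer_group)
  qed
  define \<phi> where "\<phi> = (\<lambda>c\<in>singular_chain_set 1 X. k (Q c))"
  have \<phi>_eq: "\<phi> c = k c" if "singular_relcycle 1 X {} c" for c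
    using that by (simp add: \<phi>_def singular_cycle Q_def)
  have car: "\<phi> \<in> carrier (cochain_group 1 X)"
    using k_add [OF Q_cycle Q_cycle]
    by (auto simp: carrier_cochain_group \<phi>_def Q_add singular_chain_add)
  have "\<phi> (chain_boundary 2 d) = 0" if d: "singular_chain 2 X d" for d
  proof -
    have bd: "singular_relboundary 1 X {} (chain_boundary 2 d)"
      using d by (auto simp: singular_boundary numeral_2_eq_2)
    then have "homologous_rel_set 1 X {} (chain_boundary 2 d) = homologous_rel_set 1 X {} 0"
      unfolding homologous_rel_set_eq by (simp add: homologous_rel_def)
    moreover have "k 0 = 0"
      using k_add [of 0 0] by simp
    ultimately have "k (chain_boundary 2 d) = 0"
      by (simp add: k_def)
    then show ?thesis
      using \<phi>_eq [OF singular_relboundary_imp_relcycle [OF bd]] by simp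
  qed
  then have "coboundary_map 1 X \<phi> = \<one>\<^bsub>cochain_group (Suc 1) X\<^esub>"
    by (auto simp: coboundary_map_def one_cochain_group numeral_2_eq_2 fun_eq_iff restrict_def)
  then have "\<phi> \<in> cocycle_set 1 X"
    using car by (simp add: cocycle_set_def kernel_def)
  then show thesis
    using that \<phi>_eq by (simp add: k_def)
qed

lemma mem_circle_iff: "(x :: real ^ 2) \<in> sphere 0 1 \<longleftrightarrow> (x $ 1)\<^sup>2 + (x $ 2)\<^sup>2 = 1"
  by (simp add: norm_vec_def L2_set_def sum_2)

lemma homeomorphic_nsphere_circle: "nsphere 1 homeomorphic_space circle"
proof -
  define f :: "(nat \<Rightarrow> real) \<Rightarrow> real ^ 2" where "f x = x 0 *\<^sub>R axis 1 1 + x 1 *\<^sub>R axis 2 1" for x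
  define g :: "real ^ 2 \<Rightarrow> nat \<Rightarrow> real"
    where "g v = (\<lambda>i. if i = 0 then v $ 1 else if i = 1 then v $ 2 else 0)" for v
  have f_nth: "f x $ 1 = x 0" "f x $ 2 = x 1" for x
    by (simp_all add: f_def axis_def)
  have *: "continuous_map (nsphere 1) euclidean (\<lambda>x. x k *\<^sub>R v)" for k and v :: "real ^ 2"
  proof -
    have "continuous_map euclideanreal euclidean (\<lambda>r. r *\<^sub>R v)"
      by (auto intro: continuous_intros)
    then have "continuous_map (nsphere 1) euclidean ((\<lambda>r. r *\<^sub>R v) \<circ> (\<lambda>x. x k))"
      by (rule continuous_map_compose [OF continuous_map_nsphere_projection])
    then show ?thesis
      by (simp add: o_def)
  qed
  have "continuous_map (nsphere 1) euclidean f"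
    unfolding f_def [abs_def] by (intro continuous_map_add *)
  moreover have "f x \<in> sphere 0 1" if "x \<in> topspace (nsphere 1)" for x
    using that unfolding mem_circle_iff f_nth by (simp add: nsphere)
  ultimately have f: "continuous_map (nsphere 1) circle f"
    by (auto simp: continuous_map_in_subtopology)
  have "continuous_map circle euclideanreal (\<lambda>v. g v k)" for k
    by (cases "k = 0"; cases "k = 1") (auto simp: g_def intro: linear_continuous_on)
  then have "continuous_map circle (powertop_real UNIV) g"
    by (simp add: continuous_map_componentwise)
  moreover have "(\<Sum>i\<le>1. (g v i)\<^sup>2) = 1 \<and> (\<forall>i>1. g v i = 0)" if "v \<in> sphere 0 1" for v
    using that unfolding mem_circle_iff by (simp add: g_def)
  ultimately have g: "continuous_map circle (nsphere 1) g"
    unfolding nsphere by (auto simp: continuous_map_in_subtopology)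
  have "g (f x) = x" if "x \<in> topspace (nsphere 1)" for x
  proof
    show "g (f x) k = x k" for k
      using that f_nth [of x] by (auto simp: g_def nsphere)
  qed
  moreover have "f (g v) = v" for v
    using f_nth [of "g v"] by (simp add: vec_eq_iff forall_2 g_def)
  ultimately have "homeomorphic_maps (nsphere 1) circle f g"
    using f g by (simp add: homeomorphic_maps_def)
  then show ?thesis
    by (rule homeomorphic_maps_imp_homeomorphic_space)
qed

lemma path_connected_circle: "path_connected_space circle"
  using path_connected_sphere [of "0 :: real ^ 2" 1]
  by simp

text \<open>
  Some class takes the value \<open>1\<close> on some cycle, because the first homology of the circle is \<open>\<int>\<close>.  It is a
  multiple of the generator, so the generator cannot vanish on that cycle.  In particular the generator
  has infinite order.
\<close>
lemma generator_detected_by_cycle: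
  assumes "is_generator (cohomology_group 1 circle) d\<theta>"
  obtains z where "singular_relcycle 1 circle {} z" "kronecker z d\<theta> \<noteq> 0"
proof -
  let ?H = "homology_group 1 circle" and ?C = "cohomology_group 1 circle"
  have "?H \<cong> homology_group 1 (nsphere 1)"
    using homeomorphic_space_imp_isomorphic_homology_groups homeomorphic_nsphere_circle
      homeomorphic_space_sym by blast
  also have "homology_group 1 (nsphere 1) \<cong> integer_group"
    using reduced_homology_group_nsphere(1) [of 1] by (simp add: un_reduced_homology_group)
  finally obtain h where h: "h \<in> iso ?H integer_group"
    by (auto simp: is_iso_def)
  have "1 \<in> h ` carrier ?H"
    using h by (simp add: iso_def bij_betw_def)
  then obtain z where z: "singular_relcycle 1 circle {} z" "h (homologous_rel_set 1 circle {} z) = 1"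
    using carrier_relative_homology_group [of 1 circle "{}"] by auto
  obtain \<phi> where \<phi>: "\<phi> \<in> cocycle_set 1 circle"
    "\<And>c. singular_relcycle 1 circle {} c \<Longrightarrow> \<phi> c = h (homologous_rel_set 1 circle {} c)"
    using cocycle_extending_homology_hom [OF path_connected_circle, of h] h by (auto simp: iso_def)
  let ?A = "coboundary_set 1 circle #>\<^bsub>cocycle_group 1 circle\<^esub> \<phi>"
  interpret C: comm_group ?C
    by (rule comm_group_cohomology_group)
  interpret K: group_hom ?C integer_group "kronecker z"
    using kronecker_hom [OF z(1)] C.is_group by (simp add: group_hom_def group_hom_axioms_def)
  have d\<theta>: "d\<theta> \<in> carrier ?C"
    using assms by (simp add: is_generator_def)
  have "?A \<in> generate ?C {d\<theta>}"
    using assms coset_in_cohomology [OF \<phi>(1)] by (simp add: is_generator_def)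
  then obtain k :: int where "?A = d\<theta> [^]\<^bsub>?C\<^esub> k"
    using C.generate_pow [OF d\<theta>] by auto
  then have "k * kronecker z d\<theta> = kronecker z ?A"
    using K.hom_int_pow [OF d\<theta>, of k] by simp
  also have "\<dots> = 1"
    using kronecker_coset [OF \<phi>(1) z(1)] \<phi>(2) [OF z(1)] z(2) by simp
  finally have "kronecker z d\<theta> \<noteq> 0"
    by auto
  with z(1) show thesis
    by (rule that)
qed

section \<open>Rotations of the plane\<close>

text \<open>
  Complex multiplication in coordinates: a unit vector \<open>u\<close> acts as a rotation.
\<close>
definition rotate :: "real ^ 2 \<Rightarrow> real ^ 2 \<Rightarrow> real ^ 2"
  where "rotate u v = vector [u $ 1 * v $ 1 - u $ 2 * v $ 2, u $ 1 * v $ 2 + u $ 2 * v $ 1]"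

lemma rotate_nth [simp]:
  "rotate u v $ 1 = u $ 1 * v $ 1 - u $ 2 * v $ 2"
  "rotate u v $ 2 = u $ 1 * v $ 2 + u $ 2 * v $ 1"
  by (simp_all add: rotate_def)

lemma bounded_bilinear_rotate: "bounded_bilinear rotate"
  unfolding bilinear_conv_bounded_bilinear [symmetric] bilinear_def linear_iff
  by (simp add: vec_eq_iff forall_2 algebra_simps)

lemma norm_rotate: "norm (rotate u v) = norm u * norm v"
proof -
  have "(norm (rotate u v))\<^sup>2 = (norm u * norm v)\<^sup>2"
    unfolding power_mult_distrib power2_norm_eq_inner
    by (simp add: inner_vec_def sum_2 algebra_simps power2_eq_square)
  then show ?thesis
    by (simp add: power2_eq_iff_nonneg)
qed

text \<open>
  A path in the circle from \<open>u\<close> to \<open>1\<close> is a path of rotations.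
\<close>
lemma rotation_homotopic_id:
  assumes "u \<in> sphere 0 1"
  shows "homotopic_with (\<lambda>_. True) circle circle (rotate u) id"
proof -
  let ?e = "axis 1 1 :: real ^ 2"
  have connected: "path_connected (sphere (0 :: real ^ 2) 1)"
    using path_connected_circle by simp
  have axis_in_circle: "?e \<in> sphere 0 1"
    by (simp add: norm_axis_1)
  obtain g where g: "path g" "path_image g \<subseteq> sphere 0 1" "pathstart g = u" "pathfinish g = ?e"
    using connected assms axis_in_circle unfolding path_connected_def by metis
  have "continuous_on ({0..1} \<times> sphere 0 1) (\<lambda>(t, v). rotate (g t) v)"
    unfolding split_def
  proof (rule bounded_bilinear.continuous_on [OF bounded_bilinear_rotate])
    show "continuous_on ({0..1} \<times> sphere 0 1) (\<lambda>p. g (fst p))"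
      using g(1) unfolding path_def
      by (rule continuous_on_compose2) (auto intro: continuous_on_fst continuous_on_id)
  qed (intro continuous_on_snd continuous_on_id)
  moreover have "rotate (g t) v \<in> sphere 0 1" if "t \<in> {0..1}" "v \<in> sphere 0 1" for t v
    using that g(2) by (force simp: path_image_def norm_rotate)
  moreover have "rotate (g 0) v = rotate u v" "rotate (g 1) v = v" for v
    using g(3,4) by (auto simp: pathstart_def pathfinish_def vec_eq_iff forall_2 axis_def)
  ultimately show ?thesis
    unfolding homotopic_with_def
    by (intro exI [of _ "\<lambda>(t, v). rotate (g t) v"]) auto
qed

section \<open>The rotating square\<close>

text \<open>
  The vertices \<open>1\<close>, \<open>i\<close>, \<open>-1\<close>, \<open>-i\<close> of the inscribed square, numbered like the points of a configuration.
\<close>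
definition compass :: "nat \<Rightarrow> real ^ 2"
  where "compass k = (if k = 1 then axis 1 1 else if k = 2 then axis 2 1
                      else if k = 3 then - axis 1 1 else - axis 2 1)"

lemma norm_compass: "norm (compass k) = 1"
  by (simp add: compass_def norm_axis_1)

lemma norm_compass_diff:
  assumes "i \<in> {1..4}" "j \<in> {1..4}" "i \<noteq> j"
  shows "sqrt 2 \<le> norm (compass j - compass i)"
proof -
  have "i = 1 \<or> i = 2 \<or> i = 3 \<or> i = 4" "j = 1 \<or> j = 2 \<or> j = 3 \<or> j = 4"
    using assms by auto
  then show ?thesis
    using \<open>i \<noteq> j\<close> unfolding norm_eq_sqrt_inner real_sqrt_le_iff
    by (elim disjE) (simp_all add: compass_def inner_vec_def sum_2 axis_def)
qed

text \<open>
  The loop of configurations: the square, turned by the angle of \<open>z\<close>.  The radius \<open>1 - r\<close> pushes the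
  disks out as far as the unit disk permits.
\<close>
definition square_orbit :: "real \<Rightarrow> real ^ 2 \<Rightarrow> nat \<Rightarrow> real ^ 2"
  where "square_orbit r z = (\<lambda>k\<in>{1..4}. (1 - r) *\<^sub>R rotate (compass k) z)"

lemma square_orbit_diff:
  assumes "i \<in> {1..4}" "j \<in> {1..4}"
  shows "square_orbit r z j - square_orbit r z i = (1 - r) *\<^sub>R rotate (compass j - compass i) z"
  using assms
  by (simp add: square_orbit_def bounded_bilinear.diff_left [OF bounded_bilinear_rotate] scaleR_diff_right)

text \<open>
  The second inequality says that neighbouring vertices of the square of circumradius \<open>1 - r\<close> are far
  enough apart for disks of radius \<open>r\<close>; it is an equality for \<open>r = 1 / (1 + \<surd>2)\<close>.
\<close>
lemma radius_bound:
  assumes "r \<le> 1 / (1 + sqrt 2)"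
  shows "r < 1" "2 * r \<le> (1 - r) * sqrt 2"
proof -
  have pos: "0 < 1 + sqrt 2" by (simp add: add_pos_pos)
  have le: "r * (1 + sqrt 2) \<le> 1"
    using assms pos by (simp add: pos_le_divide_eq)
  have "1 / (1 + sqrt 2) < 1"
    using pos by (simp add: divide_less_eq)
  then show "r < 1"
    using assms by linarith
  have "r * (1 + sqrt 2) * sqrt 2 \<le> 1 * sqrt 2"
    using le by (intro mult_right_mono) auto
  then show "2 * r \<le> (1 - r) * sqrt 2"
    by (simp add: algebra_simps)
qed

lemma square_orbit_in_disk_conf_set:
  assumes "0 \<le> r" and r: "r \<le> 1 / (1 + sqrt 2)" and z: "z \<in> sphere 0 1"
  shows "square_orbit r z \<in> disk_conf_set 4 r"
proof -
  note rb = radius_bound [OF r]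
  have sep: "(1 - r) * sqrt 2 \<le> dist (square_orbit r z i) (square_orbit r z j)"
    if "i \<in> {1..4}" "j \<in> {1..4}" "i \<noteq> j" for i j
  proof -
    have "dist (square_orbit r z i) (square_orbit r z j) = (1 - r) * norm (compass i - compass j)"
      using rb z by (simp add: dist_norm square_orbit_diff [OF that(2,1)] norm_rotate)
    then show ?thesis
      using norm_compass_diff [of j i] that rb by (simp add: mult_left_mono)
  qed
  have norm: "norm (square_orbit r z k) = 1 - r" if "k \<in> {1..4}" for k
    using that rb z by (simp add: square_orbit_def norm_rotate norm_compass)
  have "inj_on (square_orbit r z) {1..4}"
  proof (rule inj_onI, rule ccontr)
    fix i j :: nat
    assume "i \<in> {1..4}" "j \<in> {1..4}" "square_orbit r z i = square_orbit r z j" "i \<noteq> j"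
    then have "(1 - r) * sqrt 2 \<le> 0"
      using sep [of i j] by simp
    then show False
      using rb(1) by (simp add: mult_le_0_iff)
  qed
  moreover have "square_orbit r z \<in> {1..4} \<rightarrow>\<^sub>E cball 0 1"
    using norm \<open>0 \<le> r\<close> by (auto simp: PiE_iff square_orbit_def)
  moreover have "disjoint_family_on (\<lambda>i. ball (square_orbit r z i) r) {1..4}"
    unfolding disjoint_family_on_def
  proof (intro ballI impI disjoint_ballI)
    fix i j :: nat
    assume "i \<in> {1..4}" "j \<in> {1..4}" "i \<noteq> j"
    then show "r + r \<le> dist (square_orbit r z i) (square_orbit r z j)"
      using sep [of i j] rb(2) by linarith
  qed
  moreover have "ball (square_orbit r z k) r \<subseteq> cball 0 1" if "k \<in> {1..4}" for k
    using norm [OF that] by (simp add: ball_subset_cball_iff)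
  ultimately show ?thesis
    by (simp add: disk_conf_set_def conf_set_def)
qed

lemma continuous_map_square_orbit:
  assumes "0 \<le> r" "r \<le> 1 / (1 + sqrt 2)"
  shows "continuous_map circle (disk_Conf 4 r) (square_orbit r)"
proof -
  have "continuous_on (sphere 0 1) (\<lambda>z. square_orbit r z k)" if "k \<in> {1..4}" for k
    using that unfolding square_orbit_def
    by (auto intro!: continuous_intros bounded_bilinear.continuous_on [OF bounded_bilinear_rotate])
  then have "continuous_map circle (product_topology (\<lambda>_. euclidean) {1..4}) (square_orbit r)"
    by (auto simp: continuous_map_componentwise square_orbit_def)
  then show ?thesis
    using square_orbit_in_disk_conf_set [OF assms]
    by (auto simp: disk_Conf_def Conf_def subtopology_subtopology continuous_map_in_subtopology
        disk_conf_set_def)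
qed

text \<open>
  The square turns rigidly, so each direction turns with it at the same speed: as a function of \<open>z\<close> it
  is a rotation.
\<close>
lemma direction_square_orbit:
  assumes "r < 1" "i \<in> {1..4}" "j \<in> {1..4}" "z \<in> sphere 0 1"
  shows "direction i j (square_orbit r z)
       = rotate ((compass j - compass i) /\<^sub>R norm (compass j - compass i)) z"
  using assms unfolding direction_def square_orbit_diff [OF assms(2,3)]
  by (simp add: norm_rotate bounded_bilinear.scaleR_left [OF bounded_bilinear_rotate])

lemma direction_square_orbit_homotopic_id:
  assumes "r < 1" "i \<in> {1..4}" "j \<in> {1..4}" "i \<noteq> j"
  shows "homotopic_with (\<lambda>_. True) circle circle (direction i j \<circ> square_orbit r) id"
proof -
  define u where "u = (compass j - compass i) /\<^sub>R norm (compass j - compass i)"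
  have "0 < sqrt (2 :: real)"
    by simp
  then have "compass j - compass i \<noteq> 0"
    using norm_compass_diff [OF assms(2-4)] by (metis norm_zero not_le)
  then have u: "u \<in> sphere 0 1"
    by (simp add: u_def)
  show ?thesis
    by (rule homotopic_with_eq [OF rotation_homotopic_id [OF u]])
      (use assms in \<open>simp_all add: direction_square_orbit u_def\<close>)
qed

text \<open>
  Along the loop of squares, each direction map is a rotation and hence homotopic to the identity, so that
  every generator pulls back to a class that pairs like \<open>A\<close>.
\<close>
lemma kronecker_conf_generator:
  assumes r: "0 \<le> r" "r \<le> 1 / (1 + sqrt 2)" and z: "singular_relcycle 1 circle {} z"
    and A: "A \<in> carrier (cohomology_group 1 circle)" and e: "e \<in> index_pairs 4"
  shows "conf_generator 4 A e \<in> carrier (cohomology_group 1 (Conf 4))"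
    and "kronecker (chain_map 1 (square_orbit r) z) (conf_generator 4 A e) = kronecker z A"
proof -
  obtain i j where e_eq: "e = (i, j)" and ij: "i \<in> {1..4}" "j \<in> {1..4}" "i \<noteq> j"
    using e by (auto simp: index_pairs_def)
  have dir: "continuous_map (Conf 4) circle (direction i j)"
    by (rule continuous_map_direction [OF ij])
  show "conf_generator 4 A e \<in> carrier (cohomology_group 1 (Conf 4))"
    using cohom_induced_closed [OF dir A] by (simp add: conf_generator_def e_eq)
  have "continuous_map circle (Conf 4) (square_orbit r)"
    using continuous_map_compose [OF continuous_map_square_orbit [OF r] continuous_map_inclusion] by simp
  then have cyc: "singular_relcycle 1 (Conf 4) {} (chain_map 1 (square_orbit r) z)"
    by (rule cycle_chain_map [OF _ z])
  have "kronecker (chain_map 1 (square_orbit r) z) (conf_generator 4 A e)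
      = kronecker (chain_map 1 (direction i j) (chain_map 1 (square_orbit r) z)) A"
    using kronecker_cohom_induced [OF dir A cyc] by (simp add: conf_generator_def e_eq)
  also have "\<dots> = kronecker (chain_map 1 (direction i j \<circ> square_orbit r) z) A"
    by (simp add: chain_map_compose)
  also have "\<dots> = kronecker (chain_map 1 id z) A"
    using direction_square_orbit_homotopic_id [OF radius_bound(1) [OF r(2)] ij] A z
    by (rule kronecker_homotopic)
  also have "\<dots> = kronecker z A"
    using z chain_map_ident by (metis singular_cycle)
  finally show "kronecker (chain_map 1 (square_orbit r) z) (conf_generator 4 A e) = kronecker z A" .
qed

section \<open>Disks too large to be packed\<close>

text \<open>
  Take coordinates \<open>(d i, t i)\<close> along \<open>x 1\<close> and perpendicular to it, up to the factor \<open>norm (x 1)\<close>.  The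
  vectors other than \<open>x 1\<close> have negative \<open>d\<close>, and two of the three have \<open>t\<close> on the same side; these
  two enclose an acute angle.
\<close>
lemma no_four_obtuse_vectors:
  fixes x :: "nat \<Rightarrow> real ^ 2"
  assumes neg: "\<And>i j. \<lbrakk>i \<in> {1..4}; j \<in> {1..4}; i \<noteq> j\<rbrakk> \<Longrightarrow> x i \<bullet> x j < 0"
  shows False
proof -
  define d where "d i = x 1 \<bullet> x i" for i
  define t where "t i = x 1 $ 1 * x i $ 2 - x 1 $ 2 * x i $ 1" for i
  have lagrange: "(x 1 \<bullet> x 1) * (x i \<bullet> x j) = d i * d j + t i * t j" for i j
    by (simp add: d_def t_def inner_vec_def sum_2 algebra_simps)
  have "t i * t j < 0" if "i \<in> {2..4}" "j \<in> {2..4}" "i \<noteq> j" for i j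
  proof -
    have "d i * d j > 0"
      using that neg [of 1 i] neg [of 1 j] by (simp add: d_def mult_neg_neg)
    moreover have "(x 1 \<bullet> x 1) * (x i \<bullet> x j) \<le> 0"
      using that neg [of i j] by (simp add: mult_nonneg_nonpos)
    ultimately show ?thesis
      using lagrange [of i j] by linarith
  qed
  from this [of 2 3] this [of 2 4] this [of 3 4] show False
    by (auto simp: mult_less_0_iff)
qed

text \<open>
  With \<open>R = 1 - r\<close>, the law of cosines gives \<open>2 (x i \<bullet> x j) \<le> 2 R\<^sup>2 - (2 r)\<^sup>2\<close>, and this is negative
  exactly because \<open>r > 1 / (1 + \<surd>2)\<close> means \<open>\<surd>2 r > R\<close>.
\<close>
lemma disk_conf_set_empty:
  assumes r: "r > 1 / (1 + sqrt 2)"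
  shows "disk_conf_set 4 r = {}"
proof -
  have r0: "r > 0"
    using r by (smt (verit) divide_pos_pos real_sqrt_ge_zero)
  have False if x: "x \<in> disk_conf_set 4 r" for x
  proof (rule no_four_obtuse_vectors)
    fix i j :: nat
    assume i: "i \<in> {1..4}" and j: "j \<in> {1..4}" and "i \<noteq> j"
    have bound: "norm (x k) \<le> 1 - r" if "k \<in> {1..4}" for k
      using x that r0 by (force simp: disk_conf_set_def ball_subset_cball_iff)
    have "ball (x i) r \<inter> ball (x j) r = {}"
      using x i j \<open>i \<noteq> j\<close> by (simp add: disk_conf_set_def disjoint_family_on_def)
    then have "midpoint (x i) (x j) \<notin> ball (x i) r \<inter> ball (x j) r"
      by simp
    then have sep: "norm (x i - x j) \<ge> 2 * r"
      unfolding Int_iff mem_ball dist_midpoint by (simp add: dist_norm norm_minus_commute)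
    have "1 - r < sqrt 2 * r"
      using r by (simp add: field_simps add_pos_pos)
    moreover have "1 - r \<ge> 0"
      using bound [OF i] norm_ge_zero [of "x i"] by linarith
    ultimately have "(1 - r)\<^sup>2 < (sqrt 2 * r)\<^sup>2"
      by (intro power_strict_mono) auto
    then have key: "(1 - r)\<^sup>2 < 2 * r\<^sup>2"
      by (simp add: power_mult_distrib)
    have "(norm (x i))\<^sup>2 \<le> (1 - r)\<^sup>2" "(norm (x j))\<^sup>2 \<le> (1 - r)\<^sup>2"
      using bound i j by (auto intro: power_mono)
    moreover have "(norm (x i - x j))\<^sup>2 \<ge> (2 * r)\<^sup>2"
      using sep r0 by (intro power_mono) auto
    moreover have "(norm (x i - x j))\<^sup>2 = (norm (x i))\<^sup>2 + (norm (x j))\<^sup>2 - 2 * (x i \<bullet> x j)"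
      by (simp add: power2_norm_eq_inner inner_diff algebra_simps inner_commute)
    ultimately show "x i \<bullet> x j < 0"
      using key by (simp add: power_mult_distrib)
  qed
  then show ?thesis
    by blast
qed

section \<open>Cohomology of the empty space\<close>

lemma cocycle_set_empty_space:
  assumes "topspace X = {}" "\<phi> \<in> cocycle_set p X"
  shows "\<phi> = \<one>\<^bsub>cochain_group p X\<^esub>"
  using cochain_zero [OF cocycle_carrier [OF assms(2)]] cocycle_carrier [OF assms(2)] assms(1)
  by (auto simp: one_cochain_group carrier_cochain_group singular_chain_empty fun_eq_iff
      extensional_def restrict_def)

lemma one_cohomology_group: "\<one>\<^bsub>cohomology_group p X\<^esub> = coboundary_set p X"
  by (simp add: cohomology_group_def FactGroup_def)

lemma cohomology_class_empty_space:
  assumes X: "topspace X = {}" and A: "A \<in> carrier (cohomology_group p X)"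
  shows "A = \<one>\<^bsub>cohomology_group p X\<^esub>"
proof -
  interpret G: comm_group "cocycle_group p X" by (rule comm_group_cocycle_group)
  obtain \<phi> where \<phi>: "\<phi> \<in> cocycle_set p X" "A = coboundary_set p X #>\<^bsub>cocycle_group p X\<^esub> \<phi>"
    using A by (rule cohomology_class_cases)
  have "\<phi> \<in> coboundary_set p X"
    using cocycle_set_empty_space [OF X \<phi>(1)] subgroup.one_closed [OF subgroup_coboundary_set] by simp
  then show ?thesis
    using G.coset_join2 [OF _ subgroup_coboundary_cocycle] \<phi> by (simp add: one_cohomology_group)
qed

section \<open>The kernel of the restriction to disk configurations\<close>

lemma group_hom_finprod_int_pow:
  assumes G: "comm_group G" and \<kappa>: "\<kappa> \<in> hom G integer_group" and "finite I"
    and a: "\<And>i. i \<in> I \<Longrightarrow> a i \<in> carrier G"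
  shows "\<kappa> (\<Otimes>\<^bsub>G\<^esub>i\<in>I. a i [^]\<^bsub>G\<^esub> (c i :: int)) = (\<Sum>i\<in>I. c i * \<kappa> (a i))"
proof -
  interpret G: comm_group G by (rule G)
  interpret K: group_hom G integer_group \<kappa>
    by (simp add: group_hom_def group_hom_axioms_def \<kappa> G.is_group)
  show ?thesis
    using \<open>finite I\<close> a
  proof (induction I rule: finite_induct)
    case (insert i J)
    then show ?case
      by (simp add: Pi_iff K.hom_int_pow)
  qed simp
qed

theorem lemma24:
  fixes r :: real
  assumes "0 \<le> r"
  shows "(r \<le> 1 / (1 + sqrt 2) \<longrightarrow>
            (\<forall>d\<theta> \<alpha> (c :: nat \<times> nat \<Rightarrow> int).
               is_generator (cohomology_group 1 circle) d\<theta> \<longrightarrow>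
               \<alpha> \<in> carrier (cohomology_group 1 (Conf 4)) \<longrightarrow>
               \<alpha> = (\<Otimes>\<^bsub>cohomology_group 1 (Conf 4)\<^esub> e \<in> index_pairs 4.
                       conf_generator 4 d\<theta> e [^]\<^bsub>cohomology_group 1 (Conf 4)\<^esub> c e) \<longrightarrow>
               (\<Sum>e\<in>index_pairs 4. c e) \<noteq> 0 \<longrightarrow>
               \<alpha> \<notin> kernel (cohomology_group 1 (Conf 4)) (cohomology_group 1 (disk_Conf 4 r))
                          (incl_pullback 1 4 r)))
       \<and> (r > 1 / (1 + sqrt 2) \<longrightarrow>
            topspace (disk_Conf 4 r) = {} \<and>
            (\<forall>p. carrier (cohomology_group p (Conf 4))
                   \<subseteq> kernel (cohomology_group p (Conf 4)) (cohomology_group p (disk_Conf 4 r))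
                            (incl_pullback p 4 r)))"
proof (intro conjI impI allI notI)
  fix d\<theta> \<alpha> and c :: "nat \<times> nat \<Rightarrow> int"
  let ?G = "cohomology_group 1 (Conf 4)" and ?D = "cohomology_group 1 (disk_Conf 4 r)"
  assume r: "r \<le> 1 / (1 + sqrt 2)"
    and gen: "is_generator (cohomology_group 1 circle) d\<theta>"
    and \<alpha>: "\<alpha> \<in> carrier ?G"
    and \<alpha>_eq: "\<alpha> = (\<Otimes>\<^bsub>?G\<^esub> e \<in> index_pairs 4. conf_generator 4 d\<theta> e [^]\<^bsub>?G\<^esub> c e)"
    and c: "(\<Sum>e\<in>index_pairs 4. c e) \<noteq> 0"
    and ker: "\<alpha> \<in> kernel ?G ?D (incl_pullback 1 4 r)"
  obtain z where z: "singular_relcycle 1 circle {} z" "kronecker z d\<theta> \<noteq> 0"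
    using generator_detected_by_cycle [OF gen] .
  define s where "s = chain_map 1 (square_orbit r) z"
  have s: "singular_relcycle 1 (disk_Conf 4 r) {} s"
    unfolding s_def by (rule cycle_chain_map [OF continuous_map_square_orbit [OF assms r] z(1)])
  have s_id: "chain_map 1 id s = s"
    using s chain_map_ident by (metis singular_cycle)
  have s': "singular_relcycle 1 (Conf 4) {} s"
    using cycle_chain_map [OF continuous_map_inclusion s] s_id by simp
  have d\<theta>: "d\<theta> \<in> carrier (cohomology_group 1 circle)"
    using gen by (simp add: is_generator_def)
  have "finite (index_pairs 4)"
    by (rule finite_subset [of _ "{..4} \<times> {..4}"]) (auto simp: index_pairs_def)
  then have "kronecker s \<alpha> = (\<Sum>e\<in>index_pairs 4. c e * kronecker s (conf_generator 4 d\<theta> e))"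
    unfolding \<alpha>_eq using kronecker_conf_generator(1) [OF assms r z(1) d\<theta>]
    by (intro group_hom_finprod_int_pow comm_group_cohomology_group kronecker_hom s') auto
  also have "\<dots> = (\<Sum>e\<in>index_pairs 4. c e) * kronecker z d\<theta>"
    using kronecker_conf_generator(2) [OF assms r z(1) d\<theta>] by (simp add: s_def sum_distrib_right)
  finally have "kronecker s \<alpha> \<noteq> 0"
    using c z(2) by simp
  moreover have "kronecker s \<alpha> = kronecker s (incl_pullback 1 4 r \<alpha>)"
    using kronecker_cohom_induced [OF continuous_map_inclusion \<alpha> s] s_id
    by (simp add: incl_pullback_def)
  moreover have "kronecker s \<one>\<^bsub>?D\<^esub> = 0"
    using hom_one [OF kronecker_hom [OF s]] comm_group_cohomology_group [of 1 "disk_Conf 4 r"]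
    by (simp add: comm_group_def)
  ultimately show False
    using ker by (simp add: kernel_def)
next
  assume r: "r > 1 / (1 + sqrt 2)"
  show empty: "topspace (disk_Conf 4 r) = {}"
    by (simp add: topspace_disk_Conf disk_conf_set_empty [OF r])
  show "carrier (cohomology_group p (Conf 4))
      \<subseteq> kernel (cohomology_group p (Conf 4)) (cohomology_group p (disk_Conf 4 r))
          (incl_pullback p 4 r)" for p
    using cohomology_class_empty_space [OF empty cohom_induced_closed [OF continuous_map_inclusion]]
    by (auto simp: kernel_def incl_pullback_def)
qed

end
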